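(* Let $\alpha\in(0,2)$, and let the weights $(w_j)_{j\neq 0}$ be either the linear-interpolation weights $(w^T_j)$ or the quadratic-interpolation weights $(w^Q_j)$ defined in the context, all assumed positive. There is $h_0>0$ (depending only on $\alpha$ and the choice of weights) such that the following holds for every $0<h<h_0$. Let $f:(-1,1)\to\mathbb{R}$ and $g:\mathbb{R}\setminus(-1,1)\to\mathbb{R}$, with $g$ bounded. Let $u:\mathbb{R}\to\mathbb{R}$ be a solution of the extended Dirichlet problem $$(-\Delta)^{\alpha/2}u(x)=f(x)\ \text{ for } x\in(-1,1),\qquad u(x)=g(x)\ \text{ for } x\in\mathbb{R}\setminus(-1,1),$$ and assume that $u$ is smooth enough for the truncation error estimate to be valid, i.e. $u\in C^4(\mathbb{R})$ with $u$ and its derivatives up to order $4$ bounded. Let $u^h=(u^h_i)_{i\in\mathbb{Z}}$ be a solution of the discrete problem $$(-\Delta_h)^{\alpha/2}u^h_i=f(ih)\ \text{ for } i\in D_h,\qquad u^h_i=g(ih)\ \text{ for } i\in\mathbb{Z}\setminus D_h,$$ where $D_h=\{i\in\mathbb{Z}:|ih|<1\}$. Define the solution error $e^h_j=u(jh)-u^h_j$ and the truncation error $r^h_j=(-\Delta)^{\alpha/2}u(jh)-(-\Delta_h)^{\alpha/2}u_j$, where in the last term $u_j=u(jh)$. Then $$\max_{j\in D_h}|e^h_j|\le 4\max_{j\in D_h}|r^h_j|.$$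
   Context: The fractional Laplacian in one dimension is $$(-\Delta)^{\alpha/2}u(x)=C_{1,\alpha}\,\mathrm{P.V.}\!\int_{\mathbb{R}}\frac{u(x)-u(x-y)}{|y|^{1+\alpha}}\,dy,\qquad C_{1,\alpha}=\frac{\alpha 2^{\alpha-1}\Gamma\left(\frac{\alpha+1}{2}\right)}{\pi^{1/2}\Gamma\left(\frac{2-\alpha}{2}\right)}.$$ For a grid function $(u_i)_{i\in\mathbb{Z}}$ with grid spacing $h>0$ (grid points $x_i=ih$) and symmetric weights $w_{-j}=w_j$, the discrete fractional Laplacian is $$(-\Delta_h)^{\alpha/2}u_i=\sum_{j=1}^{\infty}(2u_i-u_{i+j}-u_{i-j})\,w_j .$$ For $t>0$ define $$F(t)=\begin{cases}\frac{C_{1,\alpha}}{(\alpha-1)\alpha}t^{1-\alpha},&\alpha\neq1\\ -C_{1,\alpha}\log t,&\alpha=1,\end{cases}\qquad G(t)=\begin{cases}\frac{C_{1,\alpha}}{(2-\alpha)(\alpha-1)\alpha}t^{2-\alpha},&\alpha\neq1\\ C_{1,\alpha}(t-t\log t),&\alpha=1,\end{cases}$$ so that $F''(t)=G'''(t)=C_{1,\alpha}t^{-1-\alpha}$. The linear-interpolation weights are, for $j\ge1$ (with $w^T_{-j}=w^T_j$), $$w^T_1=h^{-\alpha}\Big[\tfrac{C_{1,\alpha}}{2-\alpha}-F'(1)+F(2)-F(1)\Big],\qquad w^T_j=h^{-\alpha}\big[F(j+1)-2F(j)+F(j-1)\big]\ (j\ge2).$$ The quadratic-interpolation weights are, for $j\ge1$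 (with $w^Q_{-j}=w^Q_j$), $$w^Q_1=h^{-\alpha}\Big[\tfrac{C_{1,\alpha}}{2-\alpha}-G''(1)-\tfrac{G'(3)+3G'(1)}{2}+G(3)-G(1)\Big],$$ $$w^Q_j=2h^{-\alpha}\big[G'(j+1)+G'(j-1)-G(j+1)+G(j-1)\big]\ (j\ge2\text{ even}),$$ $$w^Q_j=h^{-\alpha}\Big[-\tfrac{G'(j+2)+6G'(j)+G'(j-2)}{2}+G(j+2)-G(j-2)\Big]\ (j\ge3\text{ odd}).$$ *)

theory Defs
  imports "HOL-Analysis.Analysis"
begin

definition C1 :: "real \<Rightarrow> real" where
  "C1 \<alpha> = \<alpha> * 2 powr (\<alpha> - 1) * Gamma ((\<alpha> + 1) / 2) / (sqrt pi * Gamma ((2 - \<alpha>) / 2))"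

(* The principal value: the integral with the symmetric interval [-eps, eps] removed. *)
definition truncated_frac_laplacian :: "real \<Rightarrow> (real \<Rightarrow> real) \<Rightarrow> real \<Rightarrow> real \<Rightarrow> real" where
  "truncated_frac_laplacian \<alpha> u x \<epsilon> =
     C1 \<alpha> * (LINT y:{y. \<epsilon> < \<bar>y\<bar>}|lborel. (u x - u (x - y)) / \<bar>y\<bar> powr (1 + \<alpha>))"

definition has_frac_laplacian :: "real \<Rightarrow> (real \<Rightarrow> real) \<Rightarrow> real \<Rightarrow> real \<Rightarrow> bool" where
  "has_frac_laplacian \<alpha> u x L \<longleftrightarrow>
     (\<forall>\<epsilon>>0. set_integrable lborel {y. \<epsilon> < \<bar>y\<bar>} (\<lambda>y. (u x - u (x - y)) / \<bar>y\<bar> powr (1 + \<alpha>))) \<and>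
     (truncated_frac_laplacian \<alpha> u x \<longlongrightarrow> L) (at_right 0)"

definition frac_laplacian :: "real \<Rightarrow> (real \<Rightarrow> real) \<Rightarrow> real \<Rightarrow> real" where
  "frac_laplacian \<alpha> u x = Lim (at_right 0) (truncated_frac_laplacian \<alpha> u x)"

lemma frac_laplacian_eq: "has_frac_laplacian \<alpha> u x L \<Longrightarrow> frac_laplacian \<alpha> u x = L"
  unfolding has_frac_laplacian_def frac_laplacian_def
  by (rule tendsto_Lim) auto

(* The n-th term of the series is the one with j = n + 1. For bounded v and the two families of
   weights below, the series converges absolutely. *)
definition discrete_frac_laplacian :: "(int \<Rightarrow> real) \<Rightarrow> (int \<Rightarrow> real) \<Rightarrow> int \<Rightarrow> real" where
  "discrete_frac_laplacian w v i =
     (\<Sum>n. (2 * v i - v (i + int (Suc n)) - v (i - int (Suc n))) * w (int (Suc n)))"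

(* F and G are only ever used, and differentiated, at arguments t > 0. *)
definition weight_F :: "real \<Rightarrow> real \<Rightarrow> real" where
  "weight_F \<alpha> t =
     (if \<alpha> \<noteq> 1 then C1 \<alpha> / ((\<alpha> - 1) * \<alpha>) * t powr (1 - \<alpha>)
      else - C1 \<alpha> * ln t)"

definition weight_G :: "real \<Rightarrow> real \<Rightarrow> real" where
  "weight_G \<alpha> t =
     (if \<alpha> \<noteq> 1 then C1 \<alpha> / ((2 - \<alpha>) * (\<alpha> - 1) * \<alpha>) * t powr (2 - \<alpha>)
      else C1 \<alpha> * (t - t * ln t))"

(* Weights are functions of the spacing h and of the index j, symmetric in j; the weight at
   j = 0 has no meaning and is set to 0. *)
definition linear_weight :: "real \<Rightarrow> real \<Rightarrow> int \<Rightarrow> real" where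
  "linear_weight \<alpha> h j =
     (let F = weight_F \<alpha>; k = real_of_int \<bar>j\<bar> in
      if j = 0 then 0
      else if \<bar>j\<bar> = 1 then h powr (-\<alpha>) * (C1 \<alpha> / (2 - \<alpha>) - deriv F 1 + F 2 - F 1)
      else h powr (-\<alpha>) * (F (k + 1) - 2 * F k + F (k - 1)))"

definition quadratic_weight :: "real \<Rightarrow> real \<Rightarrow> int \<Rightarrow> real" where
  "quadratic_weight \<alpha> h j =
     (let G = weight_G \<alpha>; G' = deriv G; G'' = deriv G'; k = real_of_int \<bar>j\<bar> in
      if j = 0 then 0
      else if \<bar>j\<bar> = 1 then
        h powr (-\<alpha>) * (C1 \<alpha> / (2 - \<alpha>) - G'' 1 - (G' 3 + 3 * G' 1) / 2 + G 3 - G 1)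
      else if even j then
        2 * h powr (-\<alpha>) * (G' (k + 1) + G' (k - 1) - G (k + 1) + G (k - 1))
      else
        h powr (-\<alpha>) * (- (G' (k + 2) + 6 * G' k + G' (k - 2)) / 2 + G (k + 2) - G (k - 2)))"

definition C4_bounded :: "(real \<Rightarrow> real) \<Rightarrow> bool" where
  "C4_bounded u \<longleftrightarrow>
     (\<forall>k<4. (deriv ^^ k) u differentiable_on UNIV) \<and>
     continuous_on UNIV ((deriv ^^ 4) u) \<and>
     (\<forall>k\<le>4. bounded (range ((deriv ^^ k) u)))"

definition grid_interior :: "real \<Rightarrow> int set" where
  "grid_interior h = {i. \<bar>real_of_int i * h\<bar> < 1}"

definition dirichlet_solution ::
  "real \<Rightarrow> (real \<Rightarrow> real) \<Rightarrow> (real \<Rightarrow> real) \<Rightarrow> (real \<Rightarrow> real) \<Rightarrow> bool" where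
  "dirichlet_solution \<alpha> f g u \<longleftrightarrow>
     (\<forall>x\<in>{-1<..<1}. has_frac_laplacian \<alpha> u x (f x)) \<and>
     (\<forall>x\<in>UNIV - {-1<..<1}. u x = g x)"

definition discrete_dirichlet_solution ::
  "(int \<Rightarrow> real) \<Rightarrow> real \<Rightarrow> (real \<Rightarrow> real) \<Rightarrow> (real \<Rightarrow> real) \<Rightarrow> (int \<Rightarrow> real) \<Rightarrow> bool" where
  "discrete_dirichlet_solution w h f g v \<longleftrightarrow>
     (\<forall>i\<in>grid_interior h. discrete_frac_laplacian w v i = f (real_of_int i * h)) \<and>
     (\<forall>i\<in>UNIV - grid_interior h. v i = g (real_of_int i * h))"

definition solution_error :: "real \<Rightarrow> (real \<Rightarrow> real) \<Rightarrow> (int \<Rightarrow> real) \<Rightarrow> int \<Rightarrow> real" where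
  "solution_error h u v j = u (real_of_int j * h) - v j"

definition truncation_error ::
  "real \<Rightarrow> (int \<Rightarrow> real) \<Rightarrow> real \<Rightarrow> (real \<Rightarrow> real) \<Rightarrow> int \<Rightarrow> real" where
  "truncation_error \<alpha> w h u j =
     frac_laplacian \<alpha> u (real_of_int j * h)
     - discrete_frac_laplacian w (\<lambda>i. u (real_of_int i * h)) j"

end

theory Submission
  imports Defs "HOL-Real_Asymp.Real_Asymp"
begin

text \<open>
  The error \<open>e = u - u\<^sup>h\<close> vanishes outside the grid interior and its discrete Laplacian there is \<open>-r\<close>.
  The barrier \<open>\<phi>(x) = 4 - x\<^sup>2\<close> on \<open>(-1, 1)\<close>, extended by \<open>0\<close>, satisfies \<open>0 \<le> \<phi> \<le> 4\<close>, and its second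
  difference with step \<open>y\<close> is at least \<open>2 min(y, 1)\<^sup>2\<close>, and at least \<open>6\<close> for \<open>y > 2\<close>. By Abel summation
  its discrete Laplacian is bounded below by a combination of tails \<open>\<Sum>\<^bsub>j > k\<^esub> w\<^sub>j\<close>. The weights telescope,
  so that these tails are at least \<open>h powr (-\<alpha>) C/\<alpha> (k + 3) powr (-\<alpha>)\<close>; the resulting lower bound tends to
  \<open>4 C / (\<alpha> (2 - \<alpha>)) + 4 C 2 powr (-\<alpha>) / \<alpha>\<close>, which exceeds \<open>1\<close> by the logarithmic convexity of the
  Gamma function. Hence the discrete Laplacian of \<open>\<phi>\<close> is at least \<open>1\<close> for small \<open>h\<close>, and the discrete
  minimum principle applied to \<open>max |r| \<phi> \<plusminus> e\<close> gives \<open>|e| \<le> 4 max |r|\<close>.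
\<close>

section \<open>Derivatives, monotonicity and convexity of \<open>weight_F\<close> and
  \<open>weight_G\<close>\<close>

lemma C1_pos:
  assumes "0 < \<alpha>" "\<alpha> < 2"
  shows "0 < C1 \<alpha>"
  using assms by (auto simp: C1_def intro!: divide_pos_pos mult_pos_pos Gamma_real_pos)

text \<open>This and \<open>weight_G_deriv\<close> absorb the case split at \<alpha> = 1; all later
  estimates of \<open>weight_F\<close> and \<open>weight_G\<close> rest on the derivatives
  alone.\<close>

lemma weight_F_deriv:
  assumes "\<alpha> \<noteq> 0" "t > 0"
  shows "(weight_F \<alpha> has_real_derivative - (C1 \<alpha> / \<alpha>) * t powr (-\<alpha>)) (at t)"
proof (cases "\<alpha> = 1")
  case True
  have "((\<lambda>t. - C1 1 * ln t) has_real_derivative - C1 1 * inverse t) (at t)"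
    using assms by (auto intro!: derivative_eq_intros simp: field_simps)
  moreover have "weight_F 1 = (\<lambda>t. - C1 1 * ln t)"
    by (auto simp: weight_F_def)
  ultimately show ?thesis
    using assms True by (simp add: powr_minus)
next
  case False
  have "((\<lambda>t. C1 \<alpha> / ((\<alpha> - 1) * \<alpha>) * t powr (1 - \<alpha>)) has_real_derivative
      C1 \<alpha> / ((\<alpha> - 1) * \<alpha>) * ((1 - \<alpha>) * t powr (1 - \<alpha> - 1))) (at t)"
    by (rule DERIV_cmult, rule has_real_derivative_powr) (use assms in auto)
  moreover have "weight_F \<alpha> = (\<lambda>t. C1 \<alpha> / ((\<alpha> - 1) * \<alpha>) * t powr (1 - \<alpha>))"
    using False by (auto simp: weight_F_def)
  moreover have "C1 \<alpha> / ((\<alpha> - 1) * \<alpha>) * ((1 - \<alpha>) * t powr (1 - \<alpha> - 1))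
      = - (C1 \<alpha> / \<alpha>) * t powr (-\<alpha>)"
    using False assms by (simp add: field_simps)
  ultimately show ?thesis by simp
qed

lemma weight_G_deriv:
  assumes "\<alpha> \<noteq> 2" "t > 0"
  shows "(weight_G \<alpha> has_real_derivative weight_F \<alpha> t) (at t)"
proof (cases "\<alpha> = 1")
  case True
  have "((\<lambda>t. C1 1 * (t - t * ln t)) has_real_derivative - C1 1 * ln t) (at t)"
    using assms by (auto intro!: derivative_eq_intros simp: field_simps)
  moreover have "weight_G 1 = (\<lambda>t. C1 1 * (t - t * ln t))"
    by (auto simp: weight_G_def)
  ultimately show ?thesis
    using True by (simp add: weight_F_def)
next
  case False
  have "((\<lambda>t. C1 \<alpha> / ((2 - \<alpha>) * (\<alpha> - 1) * \<alpha>) * t powr (2 - \<alpha>)) has_real_derivative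
      C1 \<alpha> / ((2 - \<alpha>) * (\<alpha> - 1) * \<alpha>) * ((2 - \<alpha>) * t powr (2 - \<alpha> - 1))) (at t)"
    by (rule DERIV_cmult, rule has_real_derivative_powr) (use assms in auto)
  moreover have "weight_G \<alpha> = (\<lambda>t. C1 \<alpha> / ((2 - \<alpha>) * (\<alpha> - 1) * \<alpha>) * t powr (2 - \<alpha>))"
    using False by (auto simp: weight_G_def)
  moreover have "C1 \<alpha> / ((2 - \<alpha>) * (\<alpha> - 1) * \<alpha>) * ((2 - \<alpha>) * t powr (2 - \<alpha> - 1))
      = weight_F \<alpha> t"
    using False assms by (simp add: weight_F_def)
  ultimately show ?thesis by simp
qed

lemma deriv_weight_G:
  assumes "\<alpha> \<noteq> 2" "t > 0"
  shows "deriv (weight_G \<alpha>) t = weight_F \<alpha> t"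
  by (rule DERIV_imp_deriv[OF weight_G_deriv[OF assms]])

text \<open>Mean value theorem: the slope \<open>C1 \<alpha> / \<alpha> * z powr (-\<alpha>)\<close>
  of \<open>- weight_F \<alpha>\<close> decreases in \<open>z\<close>.\<close>

lemma weight_F_diff_bounds:
  assumes "0 < \<alpha>" "\<alpha> < 2" "0 < s" "s \<le> t"
  shows "(t - s) * (C1 \<alpha> / \<alpha> * t powr (-\<alpha>)) \<le> weight_F \<alpha> s - weight_F \<alpha> t"
    and "weight_F \<alpha> s - weight_F \<alpha> t \<le> (t - s) * (C1 \<alpha> / \<alpha> * s powr (-\<alpha>))"
proof -
  have *: "(t - s) * (C1 \<alpha> / \<alpha> * t powr (-\<alpha>)) \<le> weight_F \<alpha> s - weight_F \<alpha> t \<and>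
    weight_F \<alpha> s - weight_F \<alpha> t \<le> (t - s) * (C1 \<alpha> / \<alpha> * s powr (-\<alpha>))"
  proof (cases "s = t")
    case False
    with assms have "s < t" by simp
    then obtain z where z: "s < z" "z < t"
      and eq: "weight_F \<alpha> t - weight_F \<alpha> s = (t - s) * (- (C1 \<alpha> / \<alpha>) * z powr (-\<alpha>))"
      using MVT2[of s t "weight_F \<alpha>" "\<lambda>x. - (C1 \<alpha> / \<alpha>) * x powr (-\<alpha>)"]
        weight_F_deriv assms by auto
    have "t powr (-\<alpha>) \<le> z powr (-\<alpha>)" "z powr (-\<alpha>) \<le> s powr (-\<alpha>)"
      using z assms by (auto intro!: powr_mono2')
    then have "(t - s) * (C1 \<alpha> / \<alpha> * t powr (-\<alpha>)) \<le> (t - s) * (C1 \<alpha> / \<alpha> * z powr (-\<alpha>))"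
      "(t - s) * (C1 \<alpha> / \<alpha> * z powr (-\<alpha>)) \<le> (t - s) * (C1 \<alpha> / \<alpha> * s powr (-\<alpha>))"
      using C1_pos[OF assms(1,2)] assms by (simp_all add: mult_left_mono divide_right_mono)
    with eq show ?thesis by simp
  qed simp
  from * show "(t - s) * (C1 \<alpha> / \<alpha> * t powr (-\<alpha>)) \<le> weight_F \<alpha> s - weight_F \<alpha> t"
    and "weight_F \<alpha> s - weight_F \<alpha> t \<le> (t - s) * (C1 \<alpha> / \<alpha> * s powr (-\<alpha>))" by auto
qed

lemma weight_F_antimono:
  assumes "0 < \<alpha>" "\<alpha> < 2" "0 < s" "s \<le> t"
  shows "weight_F \<alpha> t \<le> weight_F \<alpha> s"
proof -
  have "0 \<le> (t - s) * (C1 \<alpha> / \<alpha> * t powr (-\<alpha>))"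
    using assms C1_pos[OF assms(1,2)] by auto
  with weight_F_diff_bounds(1)[OF assms] show ?thesis by simp
qed

text \<open>The trapezoidal rule overestimates the integral of the convex function \<open>weight_F \<alpha> = G'\<close>.\<close>

lemma weight_G_trapezoid:
  assumes "0 < \<alpha>" "\<alpha> < 2" "0 < s" "0 \<le> d"
  shows "weight_G \<alpha> (s + d) - weight_G \<alpha> s \<le> d * (weight_F \<alpha> s + weight_F \<alpha> (s + d)) / 2"
proof -
  let ?F = "weight_F \<alpha>" and ?G = "weight_G \<alpha>"
  \<comment> \<open>Up to the constant \<open>weight_G \<alpha> s\<close>, \<open>H t\<close> is the
    trapezoidal value minus the integral over \<open>[s, s + t]\<close>; it remains to see that its
    derivative \<open>H'\<close> is nonnegative.\<close>
  define H where "H t = t * (?F s + ?F (s + t)) / 2 - ?G (s + t)" for t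
  define H' where "H' t = (?F s - ?F (s + t) - t * (C1 \<alpha> / \<alpha> * (s + t) powr (-\<alpha>))) / 2" for t
  have "H 0 \<le> H d"
  proof (rule DERIV_nonneg_imp_nondecreasing[OF \<open>0 \<le> d\<close>])
    fix t :: real assume t: "0 \<le> t" "t \<le> d"
    have F: "((\<lambda>t. ?F (s + t)) has_real_derivative - (C1 \<alpha> / \<alpha>) * (s + t) powr (-\<alpha>)) (at t)"
      using weight_F_deriv[of \<alpha> "t + s"] t assms
      unfolding DERIV_shift by (simp add: add.commute)
    have G: "((\<lambda>t. ?G (s + t)) has_real_derivative ?F (s + t)) (at t)"
      using weight_G_deriv[of \<alpha> "t + s"] t assms
      unfolding DERIV_shift by (simp add: add.commute)
    have "(H has_real_derivative H' t) (at t)"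
      unfolding H_def H'_def
      by (rule derivative_eq_intros F G refl | simp add: field_simps)+
    moreover have "0 \<le> H' t"
      using weight_F_diff_bounds(1)[of \<alpha> s "s + t"] t assms by (simp add: H'_def)
    ultimately show "\<exists>y. (H has_real_derivative y) (at t) \<and> 0 \<le> y" by blast
  qed
  then show ?thesis by (simp add: H_def)
qed

lemma weight_G_diff_bounds:
  assumes "0 < \<alpha>" "\<alpha> < 2" "0 < s" "s < t"
  shows "(t - s) * weight_F \<alpha> t \<le> weight_G \<alpha> t - weight_G \<alpha> s"
    and "weight_G \<alpha> t - weight_G \<alpha> s \<le> (t - s) * weight_F \<alpha> s"
proof -
  obtain z where z: "s < z" "z < t"
    and eq: "weight_G \<alpha> t - weight_G \<alpha> s = (t - s) * weight_F \<alpha> z"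
    using MVT2[of s t "weight_G \<alpha>" "weight_F \<alpha>"] weight_G_deriv assms by auto
  show "(t - s) * weight_F \<alpha> t \<le> weight_G \<alpha> t - weight_G \<alpha> s"
    "weight_G \<alpha> t - weight_G \<alpha> s \<le> (t - s) * weight_F \<alpha> s"
    unfolding eq using z assms by (auto intro!: mult_left_mono weight_F_antimono)
qed

section \<open>Telescoping tails of the weights and their lower bounds\<close>

text \<open>
  Both weight sequences telescope: up to the factor \<open>h powr (-\<alpha>)\<close>, these are closed forms of
  \<open>\<Sum>\<^bsub>j > k\<^esub> w\<^sub>j\<close>, valid for \<open>k \<ge> 1\<close>.
\<close>

definition linear_tail :: "real \<Rightarrow> nat \<Rightarrow> real" where
  "linear_tail \<alpha> k = weight_F \<alpha> k - weight_F \<alpha> (k + 1)"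

definition quadratic_tail :: "real \<Rightarrow> nat \<Rightarrow> real" where
  "quadratic_tail \<alpha> k =
     (if odd k
      then (weight_F \<alpha> (real k + 2) + 3 * weight_F \<alpha> k) / 2
        - weight_G \<alpha> (real k + 2) + weight_G \<alpha> k
      else weight_G \<alpha> (real k + 1) - weight_G \<alpha> (real k - 1)
        - (3 * weight_F \<alpha> (real k + 1) + weight_F \<alpha> (real k - 1)) / 2)"

lemma linear_weight_telescope:
  assumes "1 \<le> k"
  shows "linear_weight \<alpha> h (int (Suc k)) = h powr (-\<alpha>) * (linear_tail \<alpha> k - linear_tail \<alpha> (Suc k))"
  using assms by (simp add: linear_weight_def linear_tail_def Let_def algebra_simps)

lemma quadratic_weight_telescope:
  assumes "\<alpha> \<noteq> 2" "1 \<le> k"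
  shows "quadratic_weight \<alpha> h (int (Suc k))
    = h powr (-\<alpha>) * (quadratic_tail \<alpha> k - quadratic_tail \<alpha> (Suc k))"
proof (cases "odd k")
  case True
  have "quadratic_weight \<alpha> h (int (Suc k)) = 2 * h powr (-\<alpha>) *
      (deriv (weight_G \<alpha>) (real k + 2) + deriv (weight_G \<alpha>) (real k)
        - weight_G \<alpha> (real k + 2) + weight_G \<alpha> (real k))"
    using True assms by (auto simp: quadratic_weight_def Let_def add_ac)
  then show ?thesis
    using True assms by (simp add: quadratic_tail_def deriv_weight_G field_simps)
next
  case False
  \<comment> \<open>Then \<open>k - 1\<close> is positive, as \<open>deriv_weight_G\<close>
    requires.\<close>
  with assms have "2 \<le> k" by (cases "k = 1") auto
  have "quadratic_weight \<alpha> h (int (Suc k)) = h powr (-\<alpha>) *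
      (- (deriv (weight_G \<alpha>) (real k + 3) + 6 * deriv (weight_G \<alpha>) (real k + 1)
         + deriv (weight_G \<alpha>) (real k - 1)) / 2
        + weight_G \<alpha> (real k + 3) - weight_G \<alpha> (real k - 1))"
    using False \<open>2 \<le> k\<close> by (auto simp: quadratic_weight_def Let_def add_ac)
  then show ?thesis
    using False assms \<open>2 \<le> k\<close>
    by (simp add: quadratic_tail_def deriv_weight_G field_simps)
qed

text \<open>For \<alpha> \<le> 1 \<open>weight_F\<close> is unbounded at infinity, but its
  differences over bounded windows vanish. The window from \<open>k - 1\<close> to
  \<open>k + 2\<close> contains every argument in either tail formula.\<close>

lemma weight_F_diff_tendsto_0:
  assumes "0 < \<alpha>" "\<alpha> < 2"
  shows "(\<lambda>k. weight_F \<alpha> (real k - 1) - weight_F \<alpha> (real k + 2)) \<longlonglongrightarrow> 0"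
proof (rule tendsto_sandwich[where f = "\<lambda>_. 0"
      and h = "\<lambda>k. 3 * (C1 \<alpha> / \<alpha> * (real k - 1) powr (-\<alpha>))"])
  show "\<forall>\<^sub>F k in sequentially. 0 \<le> weight_F \<alpha> (real k - 1) - weight_F \<alpha> (real k + 2)"
    using eventually_ge_at_top[of 2]
    by eventually_elim (use assms in \<open>auto intro!: weight_F_antimono\<close>)
  show "\<forall>\<^sub>F k in sequentially. weight_F \<alpha> (real k - 1) - weight_F \<alpha> (real k + 2)
      \<le> 3 * (C1 \<alpha> / \<alpha> * (real k - 1) powr (-\<alpha>))"
    using eventually_ge_at_top[of 2]
  proof eventually_elim
    case (elim k)
    with weight_F_diff_bounds(2)[of \<alpha> "real k - 1" "real k + 2"] assms show ?case by simp
  qed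
  have "filterlim (\<lambda>k. real k - 1) at_top sequentially"
    by real_asymp
  then have "(\<lambda>k. (real k - 1) powr (-\<alpha>)) \<longlonglongrightarrow> 0"
    by (intro tendsto_neg_powr) (use assms in auto)
  then show "(\<lambda>k. 3 * (C1 \<alpha> / \<alpha> * (real k - 1) powr (-\<alpha>))) \<longlonglongrightarrow> 0"
    by (intro tendsto_mult_right_zero)
qed simp

lemma linear_tail_tendsto_0:
  assumes "0 < \<alpha>" "\<alpha> < 2"
  shows "linear_tail \<alpha> \<longlonglongrightarrow> 0"
proof (rule tendsto_sandwich[OF _ _ tendsto_const weight_F_diff_tendsto_0[OF assms]])
  show "\<forall>\<^sub>F k in sequentially. 0 \<le> linear_tail \<alpha> k"
    using eventually_ge_at_top[of 1]
    by eventually_elim (use assms in \<open>auto simp: linear_tail_def intro!: weight_F_antimono\<close>)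
  show "\<forall>\<^sub>F k in sequentially.
      linear_tail \<alpha> k \<le> weight_F \<alpha> (real k - 1) - weight_F \<alpha> (real k + 2)"
    using eventually_ge_at_top[of 2]
  proof eventually_elim
    case (elim k)
    have "weight_F \<alpha> k \<le> weight_F \<alpha> (real k - 1)"
      "weight_F \<alpha> (real k + 2) \<le> weight_F \<alpha> (k + 1)"
      using elim assms by (auto intro!: weight_F_antimono)
    then show ?case by (simp add: linear_tail_def)
  qed
qed

text \<open>The difference of \<open>weight_G\<close> over a panel of length 2 lies between twice
  the end-point values of \<open>weight_F\<close>, and the coefficients of \<open>weight_F\<close>
  add up to 2 in absolute value; so only the variation of \<open>weight_F\<close> over the window
  remains.\<close>

lemma quadratic_tail_tendsto_0:
  assumes "0 < \<alpha>" "\<alpha> < 2"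
  shows "quadratic_tail \<alpha> \<longlonglongrightarrow> 0"
proof (rule Lim_null_comparison)
  show "(\<lambda>k. 2 * (weight_F \<alpha> (real k - 1) - weight_F \<alpha> (real k + 2))) \<longlonglongrightarrow> 0"
    by (intro tendsto_mult_right_zero weight_F_diff_tendsto_0 assms)
  show "\<forall>\<^sub>F k in sequentially. norm (quadratic_tail \<alpha> k)
      \<le> 2 * (weight_F \<alpha> (real k - 1) - weight_F \<alpha> (real k + 2))"
    using eventually_ge_at_top[of 2]
  proof eventually_elim
    case (elim k)
    have mono: "weight_F \<alpha> k \<le> weight_F \<alpha> (real k - 1)"
      "weight_F \<alpha> (real k + 1) \<le> weight_F \<alpha> k"
      "weight_F \<alpha> (real k + 2) \<le> weight_F \<alpha> (real k + 1)"
      using elim assms by (auto intro!: weight_F_antimono)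
    show ?case
      using mono elim assms
        weight_G_diff_bounds[of \<alpha> "real k - 1" "real k + 1"]
        weight_G_diff_bounds[of \<alpha> "real k" "real k + 2"]
      by (auto simp: quadratic_tail_def abs_le_iff add_divide_distrib)
  qed
qed

lemma linear_tail_lower:
  assumes "0 < \<alpha>" "\<alpha> < 2" "1 \<le> k"
  shows "C1 \<alpha> / \<alpha> * (real k + 1) powr (-\<alpha>) \<le> linear_tail \<alpha> k"
  using weight_F_diff_bounds(1)[of \<alpha> k "real k + 1"] assms
  by (simp add: linear_tail_def add.commute)

text \<open>The trapezoidal estimate with \<open>d = 2\<close> leaves half of
  \<open>weight_F \<alpha> k - weight_F \<alpha> (k + 2)\<close>, which the slope bound
  estimates.\<close>

lemma quadratic_tail_lower:
  assumes "0 < \<alpha>" "\<alpha> < 2" "odd k"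
  shows "C1 \<alpha> / \<alpha> * (real k + 2) powr (-\<alpha>) \<le> quadratic_tail \<alpha> k"
proof -
  have "0 < k" using assms by (auto intro: Nat.gr0I)
  then show ?thesis
    using weight_F_diff_bounds(1)[of \<alpha> k "real k + 2"] weight_G_trapezoid[of \<alpha> k 2] assms
    by (simp add: quadratic_tail_def add_divide_distrib)
qed

text \<open>\<open>Q\<close> stands for either tail formula. Telescoping starts at
  \<open>w 2\<close>, as \<open>w 1\<close> has a formula of its own; hence
  \<open>1 \<le> k\<close>.\<close>

lemma tail_sums:
  fixes w :: "int \<Rightarrow> real"
  assumes tele: "\<And>k. 1 \<le> k \<Longrightarrow> w (int (Suc k)) = c * (Q k - Q (Suc k))"
    and lim: "Q \<longlonglongrightarrow> 0" and k: "1 \<le> k"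
  shows "(\<lambda>n. w (int (Suc (n + k)))) sums (c * Q k)"
proof -
  have "(\<lambda>n. Q (n + k) - Q (Suc n + k)) sums (Q (0 + k) - 0)"
    by (intro telescope_sums' LIMSEQ_ignore_initial_segment lim)
  then have "(\<lambda>n. c * (Q (n + k) - Q (Suc n + k))) sums (c * Q k)"
    by (intro sums_mult) simp
  also have "(\<lambda>n. c * (Q (n + k) - Q (Suc n + k))) = (\<lambda>n. w (int (Suc (n + k))))"
    by (rule ext, subst tele) (use k in auto)
  finally show ?thesis .
qed

lemma suminf_tail_Suc_le:
  fixes w :: "nat \<Rightarrow> real"
  assumes "summable w" "\<And>n. 0 \<le> w n"
  shows "(\<Sum>n. w (n + Suc k)) \<le> (\<Sum>n. w (n + k))"
proof -
  have "(\<Sum>n. w (n + k)) = (\<Sum>n. w (Suc n + k)) + w k"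
    using suminf_split_head[of "\<lambda>n. w (n + k)"] summable_ignore_initial_segment[OF assms(1), of k]
    by simp
  with assms(2)[of k] show ?thesis by simp
qed

text \<open>
  The trapezoidal estimate only controls odd \<open>k\<close> (the end points of the Simpson panels); positivity
  of the weights transfers the bound to even \<open>k\<close>, at the price of the shift by \<open>3\<close>.
\<close>

lemma weight_tail_lower:
  assumes \<alpha>: "0 < \<alpha>" "\<alpha> < 2" and h: "0 < h"
    and w: "w = linear_weight \<alpha> \<or> w = quadratic_weight \<alpha>"
    and pos: "\<And>j. j \<noteq> 0 \<Longrightarrow> 0 < w h j"
  shows "summable (\<lambda>n. w h (int (Suc n)))"
    and "h powr (-\<alpha>) * (C1 \<alpha> / \<alpha>) * (real k + 3) powr (-\<alpha>) \<le> (\<Sum>n. w h (int (Suc (n + k))))"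
proof -
  obtain Q where tele: "\<And>k. 1 \<le> k \<Longrightarrow> w h (int (Suc k)) = h powr (-\<alpha>) * (Q k - Q (Suc k))"
    and lim: "Q \<longlonglongrightarrow> 0"
    and low: "\<And>k. odd k \<Longrightarrow> C1 \<alpha> / \<alpha> * (real k + 2) powr (-\<alpha>) \<le> Q k"
  proof (cases "w = linear_weight \<alpha>")
    case True
    show ?thesis
    proof (rule that)
      show "w h (int (Suc k)) = h powr (-\<alpha>) * (linear_tail \<alpha> k - linear_tail \<alpha> (Suc k))"
        if "1 \<le> k" for k
        unfolding True by (rule linear_weight_telescope[OF that])
      show "linear_tail \<alpha> \<longlonglongrightarrow> 0" by (rule linear_tail_tendsto_0[OF \<alpha>])
      show "C1 \<alpha> / \<alpha> * (real k + 2) powr (-\<alpha>) \<le> linear_tail \<alpha> k" if "odd k" for k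
      proof -
        have "1 \<le> k" using that by (cases k) auto
        have "C1 \<alpha> / \<alpha> * (real k + 2) powr (-\<alpha>) \<le> C1 \<alpha> / \<alpha> * (real k + 1) powr (-\<alpha>)"
          using \<alpha> C1_pos[OF \<alpha>] by (intro mult_left_mono powr_mono2') auto
        with linear_tail_lower[OF \<alpha> \<open>1 \<le> k\<close>] show ?thesis by linarith
      qed
    qed
  next
    case False
    with w have True: "w = quadratic_weight \<alpha>" by simp
    show ?thesis
      by (rule that[of "quadratic_tail \<alpha>"])
        (use True quadratic_weight_telescope quadratic_tail_tendsto_0 quadratic_tail_lower \<alpha> in auto)
  qed
  have sums: "(\<lambda>n. w h (int (Suc (n + k)))) sums (h powr (-\<alpha>) * Q k)" if "1 \<le> k" for k
    by (rule tail_sums[OF tele lim that])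
  show summ: "summable (\<lambda>n. w h (int (Suc n)))"
    using sums_summable[OF sums[of 1]] summable_iff_shift[of "\<lambda>n. w h (int (Suc n))" 1] by simp
  have odd_case: "h powr (-\<alpha>) * (C1 \<alpha> / \<alpha>) * (real k + 2) powr (-\<alpha>)
      \<le> (\<Sum>n. w h (int (Suc (n + k))))" if "odd k" for k
  proof -
    have "1 \<le> k" using that by (cases k) auto
    have "h powr (-\<alpha>) * (C1 \<alpha> / \<alpha> * (real k + 2) powr (-\<alpha>)) \<le> h powr (-\<alpha>) * Q k"
      by (intro mult_left_mono low that) auto
    then show ?thesis
      using sums_unique[OF sums[OF \<open>1 \<le> k\<close>]] by (simp add: mult.assoc)
  qed
  show "h powr (-\<alpha>) * (C1 \<alpha> / \<alpha>) * (real k + 3) powr (-\<alpha>) \<le> (\<Sum>n. w h (int (Suc (n + k))))"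
  proof (cases "odd k")
    case True
    have "h powr (-\<alpha>) * (C1 \<alpha> / \<alpha>) * (real k + 3) powr (-\<alpha>)
        \<le> h powr (-\<alpha>) * (C1 \<alpha> / \<alpha>) * (real k + 2) powr (-\<alpha>)"
      using \<alpha> C1_pos[OF \<alpha>] by (intro mult_left_mono powr_mono2') auto
    with odd_case[OF True] show ?thesis by linarith
  next
    case False
    \<comment> \<open>This includes \<open>k = 0\<close>, where \<open>w h 1\<close> is simply
      dropped by positivity. The odd bound at \<open>k + 1\<close> produces the shift 3.\<close>
    have "h powr (-\<alpha>) * (C1 \<alpha> / \<alpha>) * (real k + 3) powr (-\<alpha>)
        \<le> (\<Sum>n. w h (int (Suc (n + Suc k))))"
      using odd_case[of "Suc k"] False by (simp add: add_ac)
    also have "\<dots> \<le> (\<Sum>n. w h (int (Suc (n + k))))"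
      by (rule suminf_tail_Suc_le[OF summ]) (rule less_imp_le, rule pos, simp)
    finally show ?thesis .
  qed
qed


section \<open>Gamma function bounds and the barrier constant\<close>

text \<open>\<open>Gamma\<close> is 1 at both 1 and 2, and the convex function
  \<open>ln \<circ> Gamma\<close> lies below its chord.\<close>

lemma Gamma_le_one:
  assumes "1 \<le> x" "x \<le> (2::real)"
  shows "Gamma x \<le> 1"
proof -
  have "(ln \<circ> Gamma) ((1 - (x - 1)) *\<^sub>R 1 + (x - 1) *\<^sub>R 2)
      \<le> (1 - (x - 1)) * (ln \<circ> Gamma) 1 + (x - 1) * (ln \<circ> Gamma) (2::real)"
    by (rule convex_onD[OF log_convex_Gamma_real]) (use assms in auto)
  then have "ln (Gamma x) \<le> 0"
    by (simp add: Gamma_numeral algebra_simps)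
  then show ?thesis
    using assms by (simp add: ln_le_zero_iff)
qed

text \<open>Log-convexity at the midpoint of \<open>x\<close> and \<open>3 - x\<close> bounds the
  square of \<open>Gamma (3/2)\<close>, which is \<open>pi / 4\<close>, by
  \<open>Gamma x * Gamma (3 - x)\<close>; the last factor is at most 1.\<close>

lemma Gamma_ge_pi_quarter:
  assumes "1 \<le> x" "x \<le> (2::real)"
  shows "pi / 4 \<le> Gamma x"
proof -
  have pos: "0 < Gamma x" "0 < Gamma (3 - x)" using assms by auto
  have "(ln \<circ> Gamma) ((1 - 1/2) *\<^sub>R x + (1/2) *\<^sub>R (3 - x))
      \<le> (1 - 1/2) * (ln \<circ> Gamma) x + (1/2) * (ln \<circ> Gamma) (3 - x)"
    by (rule convex_onD[OF log_convex_Gamma_real]) (use assms in auto)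
  moreover have "(1 - 1/2) *\<^sub>R x + (1/2) *\<^sub>R (3 - x) = 3/2"
    by (simp add: field_simps)
  ultimately have "2 * ln (Gamma (3/2)) \<le> ln (Gamma x) + ln (Gamma (3 - x))"
    by (simp only: o_def) simp
  also have "\<dots> \<le> ln (Gamma x)"
    using Gamma_le_one[of "3 - x"] assms pos by (simp add: ln_le_zero_iff)
  finally have "ln ((Gamma (3/2))\<^sup>2) \<le> ln (Gamma x)"
    by (simp add: ln_realpow)
  moreover have "Gamma (3/2 :: real) = sqrt pi / 2"
  proof -
    have "(1/2 :: real) \<notin> \<int>\<^sub>\<le>\<^sub>0" by (auto elim!: nonpos_Ints_cases')
    then show ?thesis
      using Gamma_plus1[of "1/2 :: real"] by (simp add: Gamma_one_half_real)
  qed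
  ultimately show ?thesis
    using pos by (simp add: power_divide)
qed

text \<open>
  The right-hand side is the limit, as \<open>h\<close> tends to \<open>0\<close>, of the lower bound for the discrete
  Laplacian of the barrier; the summands come from the moment \<open>\<Sum> 2 j\<^sup>2 h\<^sup>2 w\<^sub>j\<close> over \<open>j h \<le> 1\<close>,
  completed by \<open>\<Sum> 2 w\<^sub>j\<close> over \<open>j h > 1\<close>, and from \<open>\<Sum> 4 w\<^sub>j\<close> over \<open>j h > 2\<close>.
\<close>

lemma barrier_constant_gt_one:
  assumes "0 < \<alpha>" "\<alpha> < 2"
  shows "1 < 4 * (C1 \<alpha> / \<alpha>) / (2 - \<alpha>) + 4 * (C1 \<alpha> / \<alpha>) * 2 powr (-\<alpha>)"
proof -
  define a where "a = C1 \<alpha> / \<alpha>"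
  \<comment> \<open>For \<alpha> < 1 the functional equation moves the argument into
    \<open>[1, 2]\<close> at the cost of a factor below 1.\<close>
  have num: "pi / 4 \<le> Gamma ((\<alpha> + 1) / 2)"
  proof (cases "1 \<le> (\<alpha> + 1) / 2")
    case True
    then show ?thesis using assms by (intro Gamma_ge_pi_quarter) auto
  next
    case False
    let ?s = "(\<alpha> + 1) / 2"
    have "pi / 4 \<le> Gamma (?s + 1)"
      using False assms by (intro Gamma_ge_pi_quarter) auto
    also have "\<dots> = ?s * Gamma ?s"
      using assms by (intro Gamma_plus1) (auto elim!: nonpos_Ints_cases')
    also have "\<dots> \<le> 1 * Gamma ?s"
      using False assms by (intro mult_right_mono) (auto intro!: less_imp_le Gamma_real_pos)
    finally show ?thesis by simp
  qed
  let ?t = "(2 - \<alpha>) / 2"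
  have "Gamma (?t + 1) = ?t * Gamma ?t"
    using assms by (intro Gamma_plus1) (auto elim!: nonpos_Ints_cases')
  moreover have "Gamma (?t + 1) \<le> 1"
    using assms by (intro Gamma_le_one) auto
  ultimately have den: "?t * Gamma ?t \<le> 1" by simp
  have "0 < Gamma ?t" using assms by (intro Gamma_real_pos) auto
  with den have recip: "?t \<le> 1 / Gamma ?t" by (simp only: pos_le_divide_eq)
  \<comment> \<open>Both Gamma bounds give a lower bound for \<open>a\<close> whose factors cancel
    \<open>2 - \<alpha>\<close> in one summand of the claim and \<open>2 powr (-\<alpha>)\<close> in
    the other.\<close>
  have "2 powr \<alpha> * sqrt pi * (2 - \<alpha>) / 16 = 2 powr \<alpha> * (pi / sqrt pi) * (2 - \<alpha>) / 16"
    by (simp only: real_div_sqrt pi_ge_zero)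
  also have "\<dots> = 2 powr (\<alpha> - 1) * (pi / 4) * ?t / sqrt pi"
    by (simp add: powr_diff)
  also have "\<dots> \<le> 2 powr (\<alpha> - 1) * Gamma ((\<alpha> + 1) / 2) * (1 / Gamma ?t) / sqrt pi"
    using recip num assms
    by (intro divide_right_mono mult_mono mult_nonneg_nonneg mult_left_mono)
      (auto intro!: Gamma_real_nonneg)
  also have "\<dots> = a"
    using assms by (simp add: a_def C1_def)
  finally have a: "2 powr \<alpha> * sqrt pi * (2 - \<alpha>) / 16 \<le> a" .
  have 1: "2 powr \<alpha> * sqrt pi / 4 \<le> 4 * a / (2 - \<alpha>)"
    using a assms by (simp add: pos_le_divide_eq)
  have "4 * (2 powr \<alpha> * sqrt pi * (2 - \<alpha>) / 16) * 2 powr (-\<alpha>) \<le> 4 * a * 2 powr (-\<alpha>)"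
    using a by (intro mult_right_mono mult_left_mono) auto
  moreover have "4 * (2 powr \<alpha> * sqrt pi * (2 - \<alpha>) / 16) * 2 powr (-\<alpha>) = sqrt pi * (2 - \<alpha>) / 4"
    by (simp add: powr_minus field_simps)
  ultimately have 2: "sqrt pi * (2 - \<alpha>) / 4 \<le> 4 * a * 2 powr (-\<alpha>)" by linarith
  \<comment> \<open>Thus \<open>2 powr \<alpha> + (2 - \<alpha>)\<close> is at least
    \<open>3 - \<alpha> / 3\<close>, hence at least 7/3, and \<open>sqrt pi > 12/7\<close>
    suffices.\<close>
  have "1 + \<alpha> * (2/3) \<le> 1 + \<alpha> * ln 2"
    using ln2_ge_two_thirds assms by simp
  also have "\<dots> \<le> 2 powr \<alpha>"
    using exp_ge_add_one_self[of "\<alpha> * ln 2"] by (simp add: powr_def)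
  finally have "sqrt pi / 4 * (7/3) \<le> sqrt pi / 4 * (2 powr \<alpha> + (2 - \<alpha>))"
    using assms by (intro mult_left_mono) auto
  moreover have "12/7 < sqrt pi"
    using pi_gt3 by (intro real_less_rsqrt) (simp add: power2_eq_square)
  ultimately have "1 < sqrt pi / 4 * (2 powr \<alpha> + (2 - \<alpha>))" by linarith
  also have "\<dots> = 2 powr \<alpha> * sqrt pi / 4 + sqrt pi * (2 - \<alpha>) / 4"
    by (simp add: field_simps)
  finally show ?thesis using 1 2 by (simp add: a_def)
qed

section \<open>The barrier bound in the limit of small spacing\<close>

text \<open>The derivative's power is split as \<open>z * z powr (p - 2)\<close> because
  \<open>p - 1\<close> may have either sign, whereas \<open>p - 2\<close> is never positive.\<close>

lemma powr_diff_le: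
  assumes "0 \<le> p" "p \<le> 2" "1 \<le> (x::real)"
  shows "(x + 1) powr p - x powr p \<le> p * ((x + 1) * x powr (p - 2))"
proof -
  obtain z where z: "x < z" "z < x + 1"
    and eq: "(x + 1) powr p - x powr p = (x + 1 - x) * (p * z powr (p - 1))"
    using MVT2[of x "x + 1" "\<lambda>x. x powr p" "\<lambda>x. p * x powr (p - 1)"]
      has_real_derivative_powr assms by auto
  have "z powr (p - 1) = z * z powr (p - 2)"
    using z assms by (simp add: powr_mult_base)
  also have "\<dots> \<le> (x + 1) * x powr (p - 2)"
    using z assms by (intro mult_mono powr_mono2') auto
  finally show ?thesis
    using eq assms by (simp add: mult_left_mono)
qed

text \<open>With \<open>p = 2 - \<alpha>\<close>, the sum of
  \<open>(2 * k + 1) * (k + 3) powr (-\<alpha>)\<close> over \<open>k < K\<close> grows like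
  \<open>2 / p * K powr p\<close>, which yields the term \<open>4 * a / (2 - \<alpha>)\<close>. The
  proof settles for a constant \<open>c < 2\<close> in place of 2.\<close>

lemma eventually_barrier_sum_ge_one:
  fixes a \<alpha> :: real
  assumes \<alpha>: "0 < \<alpha>" "\<alpha> < 2" and a: "0 < a"
    and gt: "1 < 4 * a / (2 - \<alpha>) + 4 * a * 2 powr (-\<alpha>)"
  shows "\<forall>\<^sub>F h in at_right 0.
    1 \<le> (\<Sum>k<nat \<lfloor>1/h\<rfloor>. 2 * h\<^sup>2 * (2 * real k + 1) * (h powr (-\<alpha>) * a * (real k + 3) powr (-\<alpha>)))
      + 4 * (h powr (-\<alpha>) * a * (real (nat \<lfloor>2/h\<rfloor>) + 3) powr (-\<alpha>))"
proof -
  define p where "p = 2 - \<alpha>"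
  have p: "0 < p" "p < 2" "- \<alpha> = p - 2" using \<alpha> by (auto simp: p_def)
  \<comment> \<open>At \<open>c = 2\<close> the required inequality is \<open>gt\<close>; being
    strict, it survives for some smaller \<open>c\<close>, and the \<open>max\<close> keeps
    \<open>c\<close> positive.\<close>
  have "max 0 ((1 - 4 * a * 2 powr (-\<alpha>)) / (2 * a / p)) < 2"
    using gt a p by (simp add: p_def[symmetric] divide_simps) (simp add: algebra_simps)
  then obtain c where "max 0 ((1 - 4 * a * 2 powr (-\<alpha>)) / (2 * a / p)) < c" "c < 2"
    using dense by blast
  then have c: "0 < c" "c < 2" "1 < 2 * a * (c / p) + 4 * a * 2 powr (-\<alpha>)"
    using a p(1,2) by (simp_all add: field_simps)
  \<comment> \<open>From \<open>k = N\<close> on, \<open>c * (k + 4) \<le> 2 * k + 1\<close>, so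
    each summand dominates an increment of \<open>c / p * (k + 3) powr p\<close>.\<close>
  obtain N :: nat where N: "(4 * c - 1) / (2 - c) \<le> real N"
    using real_arch_simple by blast
  have step: "c / p * ((real (Suc k) + 3) powr p - (real k + 3) powr p)
      \<le> (2 * real k + 1) * (real k + 3) powr (-\<alpha>)" if "N \<le> k" for k
  proof -
    have "(real k + 4) powr p - (real k + 3) powr p
        \<le> p * ((real k + 4) * (real k + 3) powr (-\<alpha>))"
      using powr_diff_le[of p "real k + 3"] p by (simp add: add.commute)
    then have "c / p * ((real k + 4) powr p - (real k + 3) powr p)
        \<le> c / p * (p * ((real k + 4) * (real k + 3) powr (-\<alpha>)))"
      using c p by (intro mult_left_mono) auto
    also have "\<dots> = c * (real k + 4) * (real k + 3) powr (-\<alpha>)"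
      using p by simp
    also have "\<dots> \<le> (2 * real k + 1) * (real k + 3) powr (-\<alpha>)"
    proof (intro mult_right_mono)
      have "(4 * c - 1) / (2 - c) \<le> real k" using N that by simp
      then show "c * (real k + 4) \<le> 2 * real k + 1"
        using c by (simp add: field_simps)
    qed auto
    finally show ?thesis by (simp add: add_ac)
  qed
  have sum: "c / p * ((real K + 3) powr p - (real N + 3) powr p)
      \<le> (\<Sum>k<K. (2 * real k + 1) * (real k + 3) powr (-\<alpha>))" for K :: nat
  proof (cases "N \<le> K")
    case True
    have "c / p * ((real K + 3) powr p - (real N + 3) powr p)
        = (\<Sum>k=N..<K. c / p * ((real (Suc k) + 3) powr p - (real k + 3) powr p))"
      using sum_Suc_diff'[OF True, of "\<lambda>k. (real k + 3) powr p"]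
      by (simp only: sum_distrib_left[symmetric])
    also have "\<dots> \<le> (\<Sum>k=N..<K. (2 * real k + 1) * (real k + 3) powr (-\<alpha>))"
      by (intro sum_mono step) auto
    also have "\<dots> \<le> (\<Sum>k<K. (2 * real k + 1) * (real k + 3) powr (-\<alpha>))"
      by (intro sum_mono2) auto
    finally show ?thesis .
  next
    case False
    then have "(real K + 3) powr p \<le> (real N + 3) powr p"
      using p by (intro powr_mono2) auto
    then have "c / p * ((real K + 3) powr p - (real N + 3) powr p) \<le> 0"
      using c p by (intro mult_nonneg_nonpos) auto
    also have "0 \<le> (\<Sum>k<K. (2 * real k + 1) * (real k + 3) powr (-\<alpha>))"
      by (intro sum_nonneg) auto
    finally show ?thesis .
  qed
  have "((\<lambda>h. 2 * a * (c / p) * (1 - (h * (real N + 3)) powr p) + 4 * a * (2 + 3 * h) powr (-\<alpha>))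
      \<longlongrightarrow> 2 * a * (c / p) * (1 - 0) + 4 * a * (2 + 3 * 0) powr (-\<alpha>)) (at_right 0)"
  proof (intro tendsto_intros)
    show "((\<lambda>h. (h * (real N + 3)) powr p) \<longlongrightarrow> 0) (at_right 0)"
    proof (rule tendsto_zero_powrI[where b = p])
      show "((\<lambda>h. h * (real N + 3)) \<longlongrightarrow> 0) (at_right 0)"
        by (intro tendsto_mult_left_zero tendsto_ident_at)
      show "\<forall>\<^sub>F h in at_right 0. 0 \<le> h * (real N + 3)"
        using eventually_at_right_less by eventually_elim auto
    qed (use p in auto)
  qed auto
  then have "\<forall>\<^sub>F h in at_right 0. 1 <
      2 * a * (c / p) * (1 - (h * (real N + 3)) powr p) + 4 * a * (2 + 3 * h) powr (-\<alpha>)"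
    by (rule order_tendstoD) (use c in auto)
  then show ?thesis
    using eventually_at_right_less[of 0]
  proof eventually_elim
    case (elim h)
    define K where "K = nat \<lfloor>1/h\<rfloor>"
    define L where "L = nat \<lfloor>2/h\<rfloor>"
    \<comment> \<open>The shift by 3 helps at the first cutoff and costs only the vanishing amount
      \<open>3 * h\<close> at the second.\<close>
    have "1 / h \<le> real K + 1"
      using elim(2) unfolding K_def by linarith
    then have K: "1 \<le> h * (real K + 3)" using elim(2) by (simp add: field_simps)
    have "real L \<le> 2 / h"
      using elim(2) unfolding L_def by simp
    then have L: "h * (real L + 3) \<le> 2 + 3 * h" using elim(2) by (simp add: field_simps)
    have hp: "h powr p = h\<^sup>2 * h powr (-\<alpha>)"
      using elim(2) by (simp add: p_def powr_add[symmetric] flip: powr_numeral)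
    have "(\<Sum>k<K. 2 * h\<^sup>2 * (2 * real k + 1) * (h powr (-\<alpha>) * a * (real k + 3) powr (-\<alpha>)))
        = 2 * a * (h powr p * (\<Sum>k<K. (2 * real k + 1) * (real k + 3) powr (-\<alpha>)))"
      unfolding sum_distrib_left hp by (intro sum.cong) (auto simp: algebra_simps)
    also have "\<dots> \<ge> 2 * a * (h powr p * (c / p * ((real K + 3) powr p - (real N + 3) powr p)))"
      using sum[of K] a by (intro mult_left_mono) auto
    also have "2 * a * (h powr p * (c / p * ((real K + 3) powr p - (real N + 3) powr p)))
        = 2 * a * (c / p) * ((h * (real K + 3)) powr p - (h * (real N + 3)) powr p)"
      using elim(2) by (simp add: powr_mult right_diff_distrib mult_ac)
    also have "\<dots> \<ge> 2 * a * (c / p) * (1 - (h * (real N + 3)) powr p)"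
      using K a c p by (intro mult_left_mono diff_right_mono ge_one_powr_ge_zero) auto
    finally have 1: "2 * a * (c / p) * (1 - (h * (real N + 3)) powr p)
      \<le> (\<Sum>k<K. 2 * h\<^sup>2 * (2 * real k + 1) * (h powr (-\<alpha>) * a * (real k + 3) powr (-\<alpha>)))" .
    have "4 * a * (2 + 3 * h) powr (-\<alpha>) \<le> 4 * a * (h * (real L + 3)) powr (-\<alpha>)"
      using L a elim(2) \<alpha> by (intro mult_left_mono powr_mono2') auto
    also have "\<dots> = 4 * (h powr (-\<alpha>) * a * (real L + 3) powr (-\<alpha>))"
      using elim(2) by (simp add: powr_mult)
    finally show ?case
      using 1 elim(1) unfolding K_def L_def by linarith
  qed
qed

section \<open>Abel summation of the barrier series\<close>

text \<open>Consecutive squares differ by \<open>2 * k + 1\<close>; these increments become the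
  coefficients of the tails.\<close>

lemma sum_odd_eq_min_square:
  "(\<Sum>k<K. if k \<le> n then 2 * real k + 1 else 0) = (real (min (Suc n) K))\<^sup>2"
  by (induction K) (auto simp: min_def power2_eq_square algebra_simps)

lemma sums_if_ge:
  fixes w :: "nat \<Rightarrow> real"
  assumes "summable w"
  shows "(\<lambda>n. if k \<le> n then w n else 0) sums (\<Sum>n. w (n + k))"
proof -
  have "(\<lambda>n. if k \<le> n + k then w (n + k) else 0) sums (\<Sum>n. w (n + k))"
    using summable_sums[OF summable_ignore_initial_segment[OF assms, of k]] by simp
  then show ?thesis
    using sums_iff_shift[of "\<lambda>n. if k \<le> n then w n else 0" k] by simp
qed

text \<open>
  Abel summation: the weight function \<open>2 h\<^sup>2 min(j, K)\<^sup>2 + 4 \<cdot> [j > L]\<close> is nondecreasing in \<open>j = n + 1\<close>,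
  so the series is a nonnegative combination of tails of \<open>w\<close>.
\<close>

lemma barrier_series_sums:
  fixes w :: "nat \<Rightarrow> real"
  assumes "summable w"
  shows "(\<lambda>n. (2 * h\<^sup>2 * (real (min (Suc n) K))\<^sup>2 + (if L \<le> n then 4 else 0)) * w n) sums
    ((\<Sum>k<K. 2 * h\<^sup>2 * (2 * real k + 1) * (\<Sum>n. w (n + k))) + 4 * (\<Sum>n. w (n + L)))"
proof -
  have "(\<lambda>n. (\<Sum>k<K. 2 * h\<^sup>2 * (2 * real k + 1) * (if k \<le> n then w n else 0))
        + 4 * (if L \<le> n then w n else 0)) sums
    ((\<Sum>k<K. 2 * h\<^sup>2 * (2 * real k + 1) * (\<Sum>n. w (n + k))) + 4 * (\<Sum>n. w (n + L)))"
    by (intro sums_add sums_sum sums_mult sums_if_ge assms)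
  also have "(\<lambda>n. (\<Sum>k<K. 2 * h\<^sup>2 * (2 * real k + 1) * (if k \<le> n then w n else 0))
        + 4 * (if L \<le> n then w n else 0))
      = (\<lambda>n. (2 * h\<^sup>2 * (real (min (Suc n) K))\<^sup>2 + (if L \<le> n then 4 else 0)) * w n)"
  proof
    fix n
    have "(\<Sum>k<K. 2 * h\<^sup>2 * (2 * real k + 1) * (if k \<le> n then w n else 0))
        = 2 * h\<^sup>2 * (\<Sum>k<K. if k \<le> n then 2 * real k + 1 else 0) * w n"
      unfolding sum_distrib_left sum_distrib_right by (intro sum.cong) auto
    then show "(\<Sum>k<K. 2 * h\<^sup>2 * (2 * real k + 1) * (if k \<le> n then w n else 0))
        + 4 * (if L \<le> n then w n else 0)
      = (2 * h\<^sup>2 * (real (min (Suc n) K))\<^sup>2 + (if L \<le> n then 4 else 0)) * w n"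
      by (simp add: sum_odd_eq_min_square distrib_right)
  qed
  finally show ?thesis .
qed

section \<open>The discrete Laplacian on bounded grid functions and the minimum principle\<close>

lemma discrete_frac_laplacian_summable:
  fixes v :: "int \<Rightarrow> real"
  assumes w: "\<And>j. j \<noteq> 0 \<Longrightarrow> 0 < w j" "summable (\<lambda>n. w (int (Suc n)))"
    and v: "bounded (range v)"
  shows "summable (\<lambda>n. (2 * v i - v (i + int (Suc n)) - v (i - int (Suc n))) * w (int (Suc n)))"
proof -
  obtain B where B: "\<And>i. \<bar>v i\<bar> \<le> B"
    using v by (auto simp: bounded_iff)
  show ?thesis
  proof (rule summable_comparison_test'[where N = 0])
    show "summable (\<lambda>n. 4 * B * w (int (Suc n)))"
      by (intro summable_mult w)
    fix n :: nat
    have "\<bar>2 * v i - v (i + int (Suc n)) - v (i - int (Suc n))\<bar> \<le> 4 * B"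
      using B[of i] B[of "i + int (Suc n)"] B[of "i - int (Suc n)"] by linarith
    moreover have "0 < w (int (Suc n))" by (rule w) simp
    ultimately show "norm ((2 * v i - v (i + int (Suc n)) - v (i - int (Suc n))) * w (int (Suc n)))
        \<le> 4 * B * w (int (Suc n))"
      by (simp add: abs_mult mult_right_mono del: of_nat_Suc)
  qed
qed

text \<open>\<open>suminf\<close> is unspecified on divergent series; boundedness makes both series
  converge.\<close>

lemma discrete_frac_laplacian_linear:
  assumes w: "\<And>j. j \<noteq> 0 \<Longrightarrow> 0 < w j" "summable (\<lambda>n. w (int (Suc n)))"
    and v: "bounded (range v)" "bounded (range v')"
  shows "discrete_frac_laplacian w (\<lambda>j. c * v j + d * v' j) i
    = c * discrete_frac_laplacian w v i + d * discrete_frac_laplacian w v' i"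
proof -
  note s = discrete_frac_laplacian_summable[OF w]
  have "(\<lambda>n. c * ((2 * v i - v (i + int (Suc n)) - v (i - int (Suc n))) * w (int (Suc n)))
      + d * ((2 * v' i - v' (i + int (Suc n)) - v' (i - int (Suc n))) * w (int (Suc n)))) sums
    (c * discrete_frac_laplacian w v i + d * discrete_frac_laplacian w v' i)"
    unfolding discrete_frac_laplacian_def
    by (intro sums_add sums_mult summable_sums s v)
  then show ?thesis
    unfolding discrete_frac_laplacian_def[of w "\<lambda>j. c * v j + d * v' j"]
    by (intro sums_unique[symmetric]) (simp add: algebra_simps)
qed

lemma bounded_range_if_finite_support:
  fixes v :: "'a \<Rightarrow> real"
  assumes "finite D" "\<And>i. i \<notin> D \<Longrightarrow> v i = 0"
  shows "bounded (range v)"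
proof (rule bounded_subset)
  show "bounded (insert 0 (v ` D))" using assms by (intro finite_imp_bounded) auto
  show "range v \<subseteq> insert 0 (v ` D)" using assms by auto
qed

text \<open>At a negative global minimum no summand is positive. As \<open>D\<close> is finite, some
  \<open>m + j\<close> lies outside \<open>D\<close>, where \<open>v\<close> is 0, and its summand
  is strictly negative.\<close>

lemma discrete_minimum_principle:
  assumes w: "\<And>j. j \<noteq> 0 \<Longrightarrow> 0 < w j" "summable (\<lambda>n. w (int (Suc n)))"
    and D: "finite D" and out: "\<And>i. i \<notin> D \<Longrightarrow> v i = 0"
    and super: "\<And>i. i \<in> D \<Longrightarrow> 0 \<le> discrete_frac_laplacian w v i"
  shows "0 \<le> v i"
proof (rule ccontr)
  assume neg: "\<not> 0 \<le> v i"
  with out have "i \<in> D" by force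
  define m where "m = arg_min_on v D"
  have m: "m \<in> D" and min_D: "\<And>j. j \<in> D \<Longrightarrow> v m \<le> v j"
    unfolding m_def using D \<open>i \<in> D\<close> arg_min_if_finite(1)[of D v] arg_min_least[of D _ v] by auto
  have vm: "v m < 0" using min_D[OF \<open>i \<in> D\<close>] neg by simp
  have min: "v m \<le> v j" for j
    using min_D[of j] out[of j] vm by (cases "j \<in> D") auto
  let ?t = "\<lambda>n. (2 * v m - v (m + int (Suc n)) - v (m - int (Suc n))) * w (int (Suc n))"
  have wpos: "0 < w (int (Suc n))" for n by (rule w) simp
  have summ: "summable ?t"
    by (intro discrete_frac_laplacian_summable w bounded_range_if_finite_support[OF D out])
  have nonpos: "?t n \<le> 0" for n
    using min[of "m + int (Suc n)"] min[of "m - int (Suc n)"] wpos[of n]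
    by (intro mult_nonpos_nonneg) linarith+
  have "\<not> range (\<lambda>n. m + int (Suc n)) \<subseteq> D"
  proof
    assume "range (\<lambda>n. m + int (Suc n)) \<subseteq> D"
    then have "finite (range (\<lambda>n. m + int (Suc n)))" using D finite_subset by blast
    moreover have "inj (\<lambda>n. m + int (Suc n))" by (auto intro: injI)
    ultimately show False using finite_imageD by blast
  qed
  then obtain n where "m + int (Suc n) \<notin> D" by auto
  then have "?t n < 0"
    using out[of "m + int (Suc n)"] min[of "m - int (Suc n)"] vm wpos[of n]
    by (intro mult_neg_pos) linarith+
  then have "0 < (\<Sum>n. - ?t n)"
    using nonpos by (intro suminf_pos2[of _ n] summable_minus summ) auto
  then show False
    using super[OF m] suminf_minus[OF summ] by (simp add: discrete_frac_laplacian_def)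
qed

section \<open>The barrier as a discrete supersolution\<close>

text \<open>The maximum 4 becomes the factor 4 of the theorem. Interior values exceed 3, so the drop
  to 0 outside makes second differences with long steps large.\<close>

definition grid_barrier :: "real \<Rightarrow> int \<Rightarrow> real" where
  "grid_barrier h i = (if i \<in> grid_interior h then 4 - (real_of_int i * h)\<^sup>2 else 0)"

text \<open>With both neighbours inside, the second difference is exactly twice the square of
  \<open>y\<close>. With one inside, \<open>y \<le> 2\<close> and \<open>one\<close> applies. With
  none, it is twice \<open>\<phi> x\<close>, at least 6, which also pays for the extra 4.\<close>

lemma barrier_second_difference:
  fixes \<phi> :: "real \<Rightarrow> real"
  assumes \<phi>: "\<And>x. \<phi> x = (if \<bar>x\<bar> < 1 then 4 - x\<^sup>2 else 0)"
    and x: "\<bar>x\<bar> < 1" and y: "0 \<le> y"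
  shows "2 * (min y 1)\<^sup>2 + (if 2 < y then 4 else 0) \<le> 2 * \<phi> x - \<phi> (x + y) - \<phi> (x - y)"
proof -
  have sq: "x\<^sup>2 \<le> 1" using x by (simp add: abs_square_le_1)
  have \<phi>x: "\<phi> x = 4 - x\<^sup>2" using \<phi> x by simp
  have one: "2 * (min y 1)\<^sup>2 \<le> 4 - 2 * x\<^sup>2 + (x + s * y)\<^sup>2" if s: "s = 1 \<or> s = -1" for s :: real
  proof (cases "y \<le> 1")
    case True
    \<comment> \<open>Parallelogram law: the squares of \<open>x + s * y\<close> and
      \<open>x - s * y\<close> add up to twice those of \<open>x\<close> and \<open>y\<close>, and
      the second is at most 4.\<close>
    have "\<bar>x - s * y\<bar> \<le> \<bar>2\<bar>" using x y True s by auto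
    then have "(x - s * y)\<^sup>2 \<le> 2\<^sup>2" using abs_le_square_iff by blast
    then have "2 * y\<^sup>2 \<le> 4 - 2 * x\<^sup>2 + (x + s * y)\<^sup>2"
      using s by (auto simp: power2_eq_square algebra_simps)
    with True show ?thesis by simp
  next
    case False
    have "0 \<le> (x + s * y)\<^sup>2" by simp
    moreover have "2 * (min y 1)\<^sup>2 = 2" using False by simp
    ultimately show ?thesis using sq by linarith
  qed
  have min1: "2 * (min y 1)\<^sup>2 \<le> 2"
    using y by (simp add: min_def power_le_one)
  consider "\<bar>x + y\<bar> < 1" "\<bar>x - y\<bar> < 1" | "\<bar>x + y\<bar> < 1" "\<not> \<bar>x - y\<bar> < 1"
    | "\<not> \<bar>x + y\<bar> < 1" "\<bar>x - y\<bar> < 1" | "\<not> \<bar>x + y\<bar> < 1" "\<not> \<bar>x - y\<bar> < 1" by blast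
  then show ?thesis
  proof cases
    case 1
    then have "y < 1" by linarith
    then have "2 * (min y 1)\<^sup>2 + (if 2 < y then 4 else 0) = 2 * y\<^sup>2" by simp
    also have "\<dots> = 2 * \<phi> x - \<phi> (x + y) - \<phi> (x - y)"
      using 1 x by (simp add: \<phi> power2_eq_square algebra_simps)
    finally show ?thesis by simp
  next
    case 2
    then have "\<not> 2 < y" using x by linarith
    then show ?thesis using 2 one[of 1] by (simp add: \<phi>x \<phi>[of "x + y"] \<phi>[of "x - y"])
  next
    case 3
    then have "\<not> 2 < y" using x by linarith
    then show ?thesis using 3 one[of "-1"] by (simp add: \<phi>x \<phi>[of "x + y"] \<phi>[of "x - y"])
  next
    case 4
    then show ?thesis using min1 sq by (simp add: \<phi>x \<phi>[of "x + y"] \<phi>[of "x - y"])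
  qed
qed

lemma finite_grid_interior:
  assumes "0 < h"
  shows "finite (grid_interior h)"
proof (rule finite_subset)
  show "grid_interior h \<subseteq> {- \<lceil>1/h\<rceil>..\<lceil>1/h\<rceil>}"
  proof
    fix i assume "i \<in> grid_interior h"
    then have "\<bar>real_of_int i\<bar> < 1 / h"
      using assms by (simp add: grid_interior_def abs_mult field_simps)
    then show "i \<in> {- \<lceil>1/h\<rceil>..\<lceil>1/h\<rceil>}"
      by simp linarith
  qed
qed simp

lemma bounded_grid_barrier:
  assumes "0 < h"
  shows "bounded (range (grid_barrier h))"
  by (rule bounded_range_if_finite_support[OF finite_grid_interior[OF assms]])
    (simp add: grid_barrier_def)

lemma discrete_frac_laplacian_barrier:
  assumes h: "0 < h" and w: "\<And>j. j \<noteq> 0 \<Longrightarrow> 0 < w j" "summable (\<lambda>n. w (int (Suc n)))"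
    and i: "i \<in> grid_interior h"
  shows "(\<Sum>k<nat \<lfloor>1/h\<rfloor>. 2 * h\<^sup>2 * (2 * real k + 1) * (\<Sum>n. w (int (Suc (n + k)))))
      + 4 * (\<Sum>n. w (int (Suc (n + nat \<lfloor>2/h\<rfloor>))))
    \<le> discrete_frac_laplacian w (grid_barrier h) i"
proof -
  define K where "K = nat \<lfloor>1/h\<rfloor>"
  define L where "L = nat \<lfloor>2/h\<rfloor>"
  define \<phi> :: "real \<Rightarrow> real" where "\<phi> x = (if \<bar>x\<bar> < 1 then 4 - x\<^sup>2 else 0)" for x
  have \<phi>: "grid_barrier h j = \<phi> (real_of_int j * h)" for j
    by (simp add: grid_barrier_def grid_interior_def \<phi>_def)
  have K: "real K * h \<le> 1"
    using h by (simp add: K_def flip: pos_le_divide_eq)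
  have term_le: "2 * h\<^sup>2 * (real (min (Suc n) K))\<^sup>2 + (if L \<le> n then 4 else 0)
      \<le> 2 * grid_barrier h i - grid_barrier h (i + int (Suc n))
        - grid_barrier h (i - int (Suc n))" for n
  proof -
    let ?y = "real (Suc n) * h"
    have "2 * h\<^sup>2 * (real (min (Suc n) K))\<^sup>2 = 2 * (real (min (Suc n) K) * h)\<^sup>2"
      by (simp add: power_mult_distrib)
    also have "\<dots> \<le> 2 * (min ?y 1)\<^sup>2"
    proof -
      have "real (min (Suc n) K) * h \<le> ?y" "real (min (Suc n) K) * h \<le> real K * h"
        using h by (auto intro!: mult_right_mono simp del: of_nat_Suc)
      then have "real (min (Suc n) K) * h \<le> min ?y 1" using K by simp
      then show ?thesis using h by (simp add: power_mono del: of_nat_Suc)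
    qed
    finally have 1: "2 * h\<^sup>2 * (real (min (Suc n) K))\<^sup>2 \<le> 2 * (min ?y 1)\<^sup>2" .
    \<comment> \<open>Term \<open>n\<close> belongs to the index \<open>n + 1\<close>, so
      \<open>L \<le> n\<close> already forces a step longer than 2.\<close>
    have 2: "2 < ?y" if "L \<le> n"
    proof -
      have "2 / h < real (Suc n)" using that h unfolding L_def by linarith
      then show ?thesis using h by (simp add: pos_divide_less_eq)
    qed
    have "2 * (min ?y 1)\<^sup>2 + (if 2 < ?y then 4 else 0)
        \<le> 2 * \<phi> (i * h) - \<phi> (i * h + ?y) - \<phi> (i * h - ?y)"
      by (rule barrier_second_difference[OF \<phi>_def])
        (use i h in \<open>auto simp: grid_interior_def\<close>)
    then show ?thesis
      using 1 2 by (auto simp: \<phi> algebra_simps split: if_splits)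
  qed
  note sums = barrier_series_sums[OF w(2), of h K L]
  have "(\<Sum>n. (2 * h\<^sup>2 * (real (min (Suc n) K))\<^sup>2 + (if L \<le> n then 4 else 0)) * w (int (Suc n)))
      \<le> discrete_frac_laplacian w (grid_barrier h) i"
    unfolding discrete_frac_laplacian_def
  proof (rule suminf_le)
    show "summable (\<lambda>n. (2 * h\<^sup>2 * (real (min (Suc n) K))\<^sup>2 + (if L \<le> n then 4 else 0)) * w (int (Suc n)))"
      using sums by (rule sums_summable)
    show "summable (\<lambda>n. (2 * grid_barrier h i - grid_barrier h (i + int (Suc n))
        - grid_barrier h (i - int (Suc n))) * w (int (Suc n)))"
      by (intro discrete_frac_laplacian_summable w bounded_grid_barrier h)
    show "(2 * h\<^sup>2 * (real (min (Suc n) K))\<^sup>2 + (if L \<le> n then 4 else 0)) * w (int (Suc n))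
      \<le> (2 * grid_barrier h i - grid_barrier h (i + int (Suc n))
        - grid_barrier h (i - int (Suc n))) * w (int (Suc n))" for n
      by (rule mult_right_mono[OF term_le]) (rule less_imp_le, rule w, simp)
  qed
  then show ?thesis
    using sums_unique[OF sums] unfolding K_def L_def by simp
qed

text \<open>The admissible \<open>h\<close> come from a scalar inequality in \<alpha> and
  \<open>h\<close>, so the threshold does not depend on the data of the Dirichlet problem.\<close>

lemma eventually_barrier_supersolution:
  assumes \<alpha>: "0 < \<alpha>" "\<alpha> < 2" and w: "w = linear_weight \<alpha> \<or> w = quadratic_weight \<alpha>"
  shows "\<forall>\<^sub>F h in at_right 0. (\<forall>j. j \<noteq> 0 \<longrightarrow> 0 < w h j) \<longrightarrow>
    (\<forall>i\<in>grid_interior h. 1 \<le> discrete_frac_laplacian (w h) (grid_barrier h) i)"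
proof -
  have "0 < C1 \<alpha> / \<alpha>" using C1_pos[OF \<alpha>] \<alpha> by simp
  from eventually_barrier_sum_ge_one[OF \<alpha> this barrier_constant_gt_one[OF \<alpha>]]
    eventually_at_right_less[of 0]
  show ?thesis
  proof eventually_elim
    case (elim h)
    show ?case
    proof (intro impI ballI)
      fix i
      assume pos: "\<forall>j. j \<noteq> 0 \<longrightarrow> 0 < w h j" and i: "i \<in> grid_interior h"
      have pos': "\<And>j. j \<noteq> 0 \<Longrightarrow> 0 < w h j" using pos by simp
      note tail = weight_tail_lower[OF \<alpha> elim(2) w pos']
      note elim(1)
      also have "(\<Sum>k<nat \<lfloor>1/h\<rfloor>. 2 * h\<^sup>2 * (2 * real k + 1) *
            (h powr (-\<alpha>) * (C1 \<alpha> / \<alpha>) * (real k + 3) powr (-\<alpha>)))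
          + 4 * (h powr (-\<alpha>) * (C1 \<alpha> / \<alpha>) * (real (nat \<lfloor>2/h\<rfloor>) + 3) powr (-\<alpha>))
        \<le> (\<Sum>k<nat \<lfloor>1/h\<rfloor>. 2 * h\<^sup>2 * (2 * real k + 1) * (\<Sum>n. w h (int (Suc (n + k)))))
          + 4 * (\<Sum>n. w h (int (Suc (n + nat \<lfloor>2/h\<rfloor>))))"
        by (intro add_mono sum_mono mult_left_mono tail(2)) auto
      also have "\<dots> \<le> discrete_frac_laplacian (w h) (grid_barrier h) i"
        by (rule discrete_frac_laplacian_barrier[OF elim(2) pos' tail(1) i])
      finally show "1 \<le> discrete_frac_laplacian (w h) (grid_barrier h) i" .
    qed
  qed
qed

section \<open>Stability and the error estimate\<close>

text \<open>Both \<open>R * grid_barrier h i + e i\<close> and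
  \<open>R * grid_barrier h i - e i\<close> satisfy the hypotheses of the minimum principle, and the
  barrier is at most 4.\<close>

lemma discrete_stability:
  assumes h: "0 < h" and w: "\<And>j. j \<noteq> 0 \<Longrightarrow> 0 < w j" "summable (\<lambda>n. w (int (Suc n)))"
    and barrier: "\<And>i. i \<in> grid_interior h \<Longrightarrow> 1 \<le> discrete_frac_laplacian w (grid_barrier h) i"
    and out: "\<And>i. i \<notin> grid_interior h \<Longrightarrow> e i = 0"
    and R: "\<And>i. i \<in> grid_interior h \<Longrightarrow> \<bar>discrete_frac_laplacian w e i\<bar> \<le> R"
    and i: "i \<in> grid_interior h"
  shows "\<bar>e i\<bar> \<le> 4 * R"
proof -
  have "0 \<le> R" using R[OF i] by linarith
  have *: "0 \<le> R * grid_barrier h i + s * e i" if s: "s = 1 \<or> s = -1" for s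
  proof (rule discrete_minimum_principle[OF w finite_grid_interior[OF h],
        where v = "\<lambda>i. R * grid_barrier h i + s * e i"])
    show "R * grid_barrier h j + s * e j = 0" if "j \<notin> grid_interior h" for j
      using out that by (simp add: grid_barrier_def)
    fix j assume j: "j \<in> grid_interior h"
    have "R * 1 \<le> R * discrete_frac_laplacian w (grid_barrier h) j"
      by (intro mult_left_mono barrier j \<open>0 \<le> R\<close>)
    then show "0 \<le> discrete_frac_laplacian w (\<lambda>i. R * grid_barrier h i + s * e i) j"
      using R[OF j] s
      by (subst discrete_frac_laplacian_linear[OF w bounded_grid_barrier[OF h]
            bounded_range_if_finite_support[OF finite_grid_interior[OF h] out]]) auto
  qed
  have "R * grid_barrier h i \<le> R * 4"
    using \<open>0 \<le> R\<close> by (intro mult_left_mono) (auto simp: grid_barrier_def)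
  with *[of 1] *[of "-1"] show ?thesis by simp
qed

theorem theorem4p1:
  fixes \<alpha> :: real and w :: "real \<Rightarrow> int \<Rightarrow> real"
  assumes "0 < \<alpha>" and "\<alpha> < 2"
    and "w = linear_weight \<alpha> \<or> w = quadratic_weight \<alpha>"
  shows "\<exists>h0>0. \<forall>h (f :: real \<Rightarrow> real) (g :: real \<Rightarrow> real) (u :: real \<Rightarrow> real) (uh :: int \<Rightarrow> real).
    0 < h \<longrightarrow> h < h0 \<longrightarrow>
    (\<forall>j. j \<noteq> 0 \<longrightarrow> 0 < w h j) \<longrightarrow>
    bounded (g ` (UNIV - {-1<..<1})) \<longrightarrow>
    dirichlet_solution \<alpha> f g u \<longrightarrow>
    C4_bounded u \<longrightarrow>
    discrete_dirichlet_solution (w h) h f g uh \<longrightarrow>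
    Max ((\<lambda>j. \<bar>solution_error h u uh j\<bar>) ` grid_interior h)
      \<le> 4 * Max ((\<lambda>j. \<bar>truncation_error \<alpha> (w h) h u j\<bar>) ` grid_interior h)"
proof -
  obtain h0 where "0 < h0" and h0: "\<And>h. 0 < h \<Longrightarrow> h < h0 \<Longrightarrow> (\<forall>j. j \<noteq> 0 \<longrightarrow> 0 < w h j) \<Longrightarrow>
      (\<forall>i\<in>grid_interior h. 1 \<le> discrete_frac_laplacian (w h) (grid_barrier h) i)"
    using eventually_barrier_supersolution[OF assms]
    unfolding eventually_at_right_field by auto
  show ?thesis
  proof (intro exI[of _ h0] conjI \<open>0 < h0\<close> allI impI)
    fix h :: real and f g u :: "real \<Rightarrow> real" and uh :: "int \<Rightarrow> real"
    assume h: "0 < h" "h < h0" and pos: "\<forall>j. j \<noteq> 0 \<longrightarrow> 0 < w h j"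
      and g: "bounded (g ` (UNIV - {-1<..<1}))" and u: "dirichlet_solution \<alpha> f g u"
      and C4: "C4_bounded u" and uh: "discrete_dirichlet_solution (w h) h f g uh"
    let ?D = "grid_interior h"
    let ?e = "solution_error h u uh" and ?r = "truncation_error \<alpha> (w h) h u"
    define ug where "ug = (\<lambda>i. u (real_of_int i * h))"
    have wpos: "\<And>j. j \<noteq> 0 \<Longrightarrow> 0 < w h j" using pos by simp
    note summ = weight_tail_lower(1)[OF assms(1,2) h(1) assms(3) wpos]
    have fin: "finite ?D" by (rule finite_grid_interior[OF h(1)])
    \<comment> \<open>The index set is nonempty, so both \<open>Max\<close> are genuine
      maxima.\<close>
    have "0 \<in> ?D" by (simp add: grid_interior_def)
    have outside: "real_of_int i * h \<in> UNIV - {-1<..<1}" if "i \<notin> ?D" for i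
      using that by (auto simp: grid_interior_def)
    have "bounded (range u)"
      using C4 unfolding C4_bounded_def by (auto dest!: spec[of _ "0::nat"])
    then have ug: "bounded (range ug)"
      by (rule bounded_subset) (auto simp: ug_def)
    \<comment> \<open>\<open>uh\<close> takes finitely many values in the interior and values of
      \<open>g\<close> elsewhere.\<close>
    have "bounded (uh ` ?D \<union> g ` (UNIV - {-1<..<1}))"
      using g fin by (simp add: finite_imp_bounded)
    then have uhb: "bounded (range uh)"
    proof (rule bounded_subset)
      show "range uh \<subseteq> uh ` ?D \<union> g ` (UNIV - {-1<..<1})"
        using uh outside unfolding discrete_dirichlet_solution_def by blast
    qed
    have e: "?e = (\<lambda>i. 1 * ug i + (-1) * uh i)"
      by (auto simp: solution_error_def ug_def)
    have out: "?e i = 0" if "i \<notin> ?D" for i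
      using u uh outside[OF that] that
      by (simp add: solution_error_def dirichlet_solution_def discrete_dirichlet_solution_def)
    \<comment> \<open>Both Laplacians equal \<open>f\<close> at interior grid points, so the
      difference is the truncation error with opposite sign.\<close>
    have lap: "discrete_frac_laplacian (w h) ?e i = - ?r i" if "i \<in> ?D" for i
    proof -
      have "real_of_int i * h \<in> {-1<..<1}"
        using that by (auto simp: grid_interior_def)
      then have "frac_laplacian \<alpha> u (real_of_int i * h) = f (real_of_int i * h)"
        using u by (intro frac_laplacian_eq) (simp add: dirichlet_solution_def)
      moreover have "discrete_frac_laplacian (w h) uh i = f (real_of_int i * h)"
        using uh that by (simp add: discrete_dirichlet_solution_def)
      moreover have "discrete_frac_laplacian (w h) ?e i
          = 1 * discrete_frac_laplacian (w h) ug i + (-1) * discrete_frac_laplacian (w h) uh i"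
        unfolding e by (rule discrete_frac_laplacian_linear[OF wpos summ ug uhb])
      ultimately show ?thesis
        by (simp add: truncation_error_def ug_def)
    qed
    let ?R = "Max ((\<lambda>j. \<bar>?r j\<bar>) ` ?D)"
    have R: "\<bar>discrete_frac_laplacian (w h) ?e i\<bar> \<le> ?R" if "i \<in> ?D" for i
      using lap[OF that] fin that by (simp add: Max_ge)
    have "\<bar>?e i\<bar> \<le> 4 * ?R" if "i \<in> ?D" for i
      using h0[OF h pos] by (intro discrete_stability[OF h(1) wpos summ _ out R that]) auto
    then show "Max ((\<lambda>j. \<bar>?e j\<bar>) ` ?D) \<le> 4 * ?R"
      using fin \<open>0 \<in> ?D\<close> by (intro Max.boundedI) auto
  qed
qed

end
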